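(* Let $H$ be a perfect group and let $\eta: H \to G$ be any localization, with $G$ finite. Then $G$ is perfect.
   Context: A group homomorphism $\eta: H \to G$ is called a localization if there is a localization functor $L$ (a coaugmented idempotent functor) on the category of groups such that $\eta$ coincides with the coaugmentation $H \to LH$. Equivalently, $\eta$ is a localization if and only if precomposition with $\eta$, $\psi \mapsto \psi\circ\eta$, is a bijection $\operatorname{Hom}(G,G) \to \operatorname{Hom}(H,G)$. A group is perfect if it equals its commutator subgroup. *)

theory Defs
  imports "HOL-Algebra.Generated_Groups"
begin

definition perfect_group :: "('a, 'c) monoid_scheme \<Rightarrow> bool" where
  "perfect_group G \<longleftrightarrow> group G \<and> derived G (carrier G) = carrier G"

text \<open>
  Functions in \<^term>\<open>hom G H\<close> are unconstrained outside \<^term>\<open>carrier G\<close>.  Intersecting with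
  \<^const>\<open>extensional\<close> makes each homomorphism correspond to exactly one function, which is
  needed for the bijection in the definition of a localization.
\<close>

definition ext_hom :: "('a, 'c) monoid_scheme \<Rightarrow> ('b, 'd) monoid_scheme \<Rightarrow> ('a \<Rightarrow> 'b) set" where
  "ext_hom G H = hom G H \<inter> extensional (carrier G)"

definition localization ::
  "('a, 'c) monoid_scheme \<Rightarrow> ('b, 'd) monoid_scheme \<Rightarrow> ('a \<Rightarrow> 'b) \<Rightarrow> bool" where
  "localization H G \<eta> \<longleftrightarrow>
     group H \<and> group G \<and> \<eta> \<in> hom H G \<and>
     bij_betw (\<lambda>\<psi>. compose (carrier H) \<psi> \<eta>) (ext_hom G G) (ext_hom H G)"

text \<open>
  A localization functor is a coaugmented idempotent functor on groups.  HOL has no type of all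
  groups, so such a functor can only be stated for the groups with carrier in a given type,
  whereas \<^const>\<open>localization\<close>, the description by the universal property, is independent of any
  such universe.  The theorem \<open>localization_coaugmentation\<close> shows that, whatever the universe
  type, every coaugmentation of a localization functor is a localization in that sense.
\<close>

locale localization_functor =
  fixes L :: "'u monoid \<Rightarrow> 'u monoid"
    and Lmap :: "'u monoid \<Rightarrow> 'u monoid \<Rightarrow> ('u \<Rightarrow> 'u) \<Rightarrow> ('u \<Rightarrow> 'u)"
    and coaug :: "'u monoid \<Rightarrow> 'u \<Rightarrow> 'u"
  assumes L_group: "group X \<Longrightarrow> group (L X)"
    and Lmap_hom: "\<lbrakk>group X; group Y; f \<in> ext_hom X Y\<rbrakk> \<Longrightarrow> Lmap X Y f \<in> ext_hom (L X) (L Y)"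
    and Lmap_id: "group X \<Longrightarrow> Lmap X X (restrict id (carrier X)) = restrict id (carrier (L X))"
    and Lmap_comp: "\<lbrakk>group X; group Y; group Z; f \<in> ext_hom X Y; g \<in> ext_hom Y Z\<rbrakk> \<Longrightarrow>
      Lmap X Z (compose (carrier X) g f) = compose (carrier (L X)) (Lmap Y Z g) (Lmap X Y f)"
    and coaug_hom: "group X \<Longrightarrow> coaug X \<in> ext_hom X (L X)"
    and coaug_natural: "\<lbrakk>group X; group Y; f \<in> ext_hom X Y\<rbrakk> \<Longrightarrow>
      compose (carrier X) (Lmap X Y f) (coaug X) = compose (carrier X) (coaug Y) f"
    and coaug_L_iso: "group X \<Longrightarrow> coaug (L X) \<in> iso (L X) (L (L X))"
    and Lmap_coaug_iso: "group X \<Longrightarrow> Lmap X (L X) (coaug X) \<in> iso (L X) (L (L X))"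
begin

theorem localization_coaugmentation:
  assumes H: "group H"
  shows "localization H (L H) (coaug H)"
proof -
  let ?G = "L H" and ?e = "coaug H"
  have G: "group ?G" using H by (rule L_group)
  have e: "?e \<in> ext_hom H ?G" using H by (rule coaug_hom)
  have e_car: "?e x \<in> carrier ?G" if "x \<in> carrier H" for x
    using e that by (auto simp: ext_hom_def hom_def)
  have iso1: "coaug ?G \<in> iso ?G (L ?G)" using H by (rule coaug_L_iso)
  have iso2: "Lmap H ?G ?e \<in> iso ?G (L ?G)" using H by (rule Lmap_coaug_iso)
  have inj: "inj_on (coaug ?G) (carrier ?G)"
    using iso1 by (auto simp: iso_def bij_betw_def)
  have surj: "Lmap H ?G ?e ` carrier ?G = carrier (L ?G)"
    using iso2 by (auto simp: iso_def bij_betw_def)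
  have "inj_on (\<lambda>\<psi>. compose (carrier H) \<psi> ?e) (ext_hom ?G ?G)"
  proof (rule inj_onI)
    fix p q
    assume p: "p \<in> ext_hom ?G ?G" and q: "q \<in> ext_hom ?G ?G"
      and eq: "compose (carrier H) p ?e = compose (carrier H) q ?e"
    have "compose (carrier ?G) (Lmap ?G ?G p) (Lmap H ?G ?e) =
          compose (carrier ?G) (Lmap ?G ?G q) (Lmap H ?G ?e)"
      using Lmap_comp[OF H G G e p] Lmap_comp[OF H G G e q] eq by simp
    note eqL = this
    have *: "Lmap ?G ?G p y = Lmap ?G ?G q y" if y: "y \<in> carrier (L ?G)" for y
    proof -
      obtain x where x: "x \<in> carrier ?G" "y = Lmap H ?G ?e x"
        using y surj by blast
      show ?thesis using fun_cong[OF eqL, of x] x by (simp add: compose_eq)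
    qed
    show "p = q"
    proof (rule extensionalityI)
      show "p \<in> extensional (carrier ?G)" "q \<in> extensional (carrier ?G)"
        using p q by (auto simp: ext_hom_def)
    next
      fix x assume x: "x \<in> carrier ?G"
      have cx: "coaug ?G x \<in> carrier (L ?G)"
        using iso1 x by (auto simp: iso_def hom_def)
      have "coaug ?G (p x) = Lmap ?G ?G p (coaug ?G x)"
        using fun_cong[OF coaug_natural[OF G G p], of x] x by (simp add: compose_eq)
      also have "\<dots> = Lmap ?G ?G q (coaug ?G x)" using * cx by simp
      also have "\<dots> = coaug ?G (q x)"
        using fun_cong[OF coaug_natural[OF G G q], of x] x by (simp add: compose_eq)
      finally show "p x = q x"
        using inj_onD[OF inj] p q x by (auto simp: ext_hom_def hom_def)
    qed
  qed
  moreover have "compose (carrier H) p ?e \<in> ext_hom H ?G" if p: "p \<in> ext_hom ?G ?G" for p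
    using p e H by (auto simp: ext_hom_def hom_def Pi_def compose_eq group.is_monoid monoid.m_closed)
  moreover have "\<exists>p\<in>ext_hom ?G ?G. compose (carrier H) p ?e = f" if f: "f \<in> ext_hom H ?G" for f
  proof -
    let ?i = "inv_into (carrier ?G) (coaug ?G)"
    have i: "?i \<in> hom (L ?G) ?G"
      using group.iso_set_sym[OF G iso1] by (simp add: iso_def)
    have Lf: "Lmap H ?G f \<in> hom ?G (L ?G)"
      using Lmap_hom[OF H G f] by (simp add: ext_hom_def)
    let ?p = "compose (carrier ?G) ?i (Lmap H ?G f)"
    have "?p \<in> ext_hom ?G ?G"
      using i Lf G by (auto simp: ext_hom_def hom_def Pi_def compose_eq group.is_monoid monoid.m_closed)
    moreover have "compose (carrier H) ?p ?e = f"
    proof (rule extensionalityI)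
      show "f \<in> extensional (carrier H)" using f by (simp add: ext_hom_def)
      fix x assume x: "x \<in> carrier H"
      have "Lmap H ?G f (?e x) = coaug ?G (f x)"
        using fun_cong[OF coaug_natural[OF H G f], of x] x by (simp add: compose_eq)
      moreover have "f x \<in> carrier ?G" using f x by (auto simp: ext_hom_def hom_def)
      ultimately show "compose (carrier H) ?p ?e x = f x"
        using x e_car inj by (simp add: compose_eq)
    qed simp
    ultimately show ?thesis by blast
  qed
  ultimately have "bij_betw (\<lambda>\<psi>. compose (carrier H) \<psi> ?e) (ext_hom ?G ?G) (ext_hom H ?G)"
    unfolding bij_betw_def by blast
  then show ?thesis
    using H G e by (simp add: localization_def ext_hom_def)
qed

end

end

theory Submission
  imports Defs "HOL-Algebra.Zassenhaus" "HOL-Algebra.Multiplicative_Group"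
begin

text \<open>
  Only the injectivity half of the universal property is needed: an endomorphism of \<open>G\<close> that
  agrees with the trivial one on the image of \<open>\<eta>\<close> is trivial.  As \<open>H\<close> is perfect, \<open>\<eta>\<close> maps it into
  the derived subgroup of \<open>G\<close>.  So it suffices to show that a finite group \<open>G\<close> that is not perfect
  has a nontrivial endomorphism that kills the derived subgroup
  (\<open>ex_nontrivial_endomorphism_killing_derived\<close>).

  To construct one, take a maximal proper subgroup \<open>M\<close> containing the derived subgroup.  It is
  normal, and by maximality \<open>G / M\<close> is cyclic, generated by the coset of any \<open>x\<close> outside \<open>M\<close>.  The
  order \<open>n > 1\<close> of this coset divides the order of \<open>x\<close>, so a power \<open>z\<close> of \<open>x\<close> has order
  exactly \<open>n\<close>.  Sending the coset of \<open>x\<close> to \<open>z\<close> defines a nontrivial homomorphism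
  \<open>G / M \<rightarrow> G\<close>, and its composite with the projection \<open>G \<rightarrow> G / M\<close> is the required endomorphism.
\<close>

lemma (in group) subgroup_containing_derived_is_normal:
  assumes K: "subgroup K G" and D: "derived G (carrier G) \<subseteq> K"
  shows "K \<lhd> G"
proof (rule normal_invI[OF K])
  interpret K: subgroup K G by fact
  fix g k assume g: "g \<in> carrier G" and k: "k \<in> K"
  have "g \<otimes> k \<otimes> inv g \<otimes> inv k \<in> derived G (carrier G)"
    unfolding derived_def using g K.mem_carrier[OF k] by (intro generate.incl) blast
  then have "g \<otimes> k \<otimes> inv g \<otimes> inv k \<otimes> k \<in> K"
    using D k K.m_closed by blast
  then show "g \<otimes> k \<otimes> inv g \<in> K"
    using g k K.mem_carrier by (simp add: m_assoc)
qed

lemma (in group) ex_maximal_proper_subgroup: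
  assumes fin: "finite (carrier G)" and D: "subgroup D G" "D \<noteq> carrier G"
  shows "\<exists>M. subgroup M G \<and> D \<subseteq> M \<and> M \<noteq> carrier G \<and>
    (\<forall>K. subgroup K G \<and> M \<subset> K \<longrightarrow> K = carrier G)"
proof -
  let ?S = "{K. subgroup K G \<and> K \<noteq> carrier G}"
  have "?S \<subseteq> Pow (carrier G)" by (auto dest: subgroup.subset)
  then have "finite ?S" using fin by (simp add: finite_subset)
  from finite_has_maximal2[OF this, of D] D
  obtain M where "M \<in> ?S" "D \<subseteq> M" "\<forall>K\<in>?S. M \<subseteq> K \<longrightarrow> M = K" by auto
  then show ?thesis by (intro exI[of _ M]) auto
qed

text \<open>
  A homomorphism out of a cyclic group may send the generator \<open>c\<close> to any element \<open>z\<close> whose order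
  divides that of \<open>c\<close>.  Orders are \<open>0\<close> for elements of infinite order, so the divisibility
  condition also covers an infinite cyclic group, where it is no restriction.
\<close>

lemma ex_hom_cyclic:
  assumes "group C" "group G"
    and c: "c \<in> carrier C" and gen: "\<And>y. y \<in> carrier C \<Longrightarrow> \<exists>k::int. y = c [^]\<^bsub>C\<^esub> k"
    and z: "z \<in> carrier G" and zc: "group.ord G z dvd group.ord C c"
  obtains f where "f \<in> hom C G" "f c = z"
proof -
  interpret C: group C by fact
  interpret G: group G by fact
  define f where "f y = z [^]\<^bsub>G\<^esub> (SOME k::int. y = c [^]\<^bsub>C\<^esub> k)" for y
  \<comment> \<open>The choice of exponent is immaterial: two exponents differ by a multiple of the order of \<open>c\<close>.\<close>
  have f: "f (c [^]\<^bsub>C\<^esub> k) = z [^]\<^bsub>G\<^esub> k" for k :: int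
  proof -
    define l :: int where "l = (SOME l. c [^]\<^bsub>C\<^esub> k = c [^]\<^bsub>C\<^esub> l)"
    have "c [^]\<^bsub>C\<^esub> k = c [^]\<^bsub>C\<^esub> l"
      unfolding l_def by (rule someI) (rule refl)
    then have "int (C.ord c) dvd k - l"
      using C.int_pow_eq[OF c, of l k] by (simp add: eq_commute)
    then have "int (G.ord z) dvd k - l"
      using zc by (meson dvd_trans of_nat_dvd_iff)
    then show ?thesis
      using G.int_pow_eq[OF z, of l k] unfolding f_def l_def[symmetric] by simp
  qed
  have "f \<in> hom C G"
  proof (rule homI)
    fix a b assume "a \<in> carrier C" "b \<in> carrier C"
    then obtain k l :: int where kl: "a = c [^]\<^bsub>C\<^esub> k" "b = c [^]\<^bsub>C\<^esub> l" using gen by blast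
    have "a \<otimes>\<^bsub>C\<^esub> b = c [^]\<^bsub>C\<^esub> (k + l)" using kl c by (simp add: C.int_pow_mult)
    then show "f (a \<otimes>\<^bsub>C\<^esub> b) = f a \<otimes>\<^bsub>G\<^esub> f b" using kl z by (simp add: f G.int_pow_mult)
  next
    fix a assume "a \<in> carrier C"
    then show "f a \<in> carrier G" using gen z f by (metis G.int_pow_closed)
  qed
  moreover have "f c = z" using f[of 1] c z by simp
  ultimately show thesis by (rule that)
qed

text \<open>
  The subgroup \<open>M\<langle>x\<rangle>\<close> contains \<open>M\<close> properly, so it is all of \<open>G\<close>.  Maximality is among all proper
  subgroups of \<open>G\<close>, not only the normal ones.
\<close>

lemma (in group) quotient_by_maximal_cyclic:
  assumes N: "M \<lhd> G" and max: "\<And>K. subgroup K G \<Longrightarrow> M \<subset> K \<Longrightarrow> K = carrier G"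
    and x: "x \<in> carrier G" "x \<notin> M" and y: "y \<in> carrier (G Mod M)"
  shows "\<exists>k::int. y = (M #> x) [^]\<^bsub>G Mod M\<^esub> k"
proof -
  interpret N: normal M G by fact
  let ?K = "M <#> generate G {x}"
  have gx: "subgroup (generate G {x}) G" using x by (intro generate_is_subgroup) simp
  have K: "subgroup ?K G" by (rule mult_norm_subgroup[OF N gx])
  have "M \<subseteq> ?K"
  proof
    fix m assume m: "m \<in> M"
    have "m \<otimes> \<one> \<in> ?K"
      unfolding set_mult_def using m subgroup.one_closed[OF gx] by blast
    then show "m \<in> ?K" using N.mem_carrier[OF m] by simp
  qed
  moreover have "\<one> \<otimes> x \<in> ?K"
    unfolding set_mult_def using N.one_closed generate.incl[of x "{x}" G] by blast
  then have "x \<in> ?K" using x by simp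
  ultimately have "?K = carrier G" using max[OF K] x by blast
  moreover obtain g where g: "g \<in> carrier G" "y = M #> g"
    using y by (auto simp: FactGroup_def RCOSETS_def)
  ultimately have "g \<in> ?K" by simp
  then obtain m h where mh: "m \<in> M" "h \<in> generate G {x}" "g = m \<otimes> h"
    unfolding set_mult_def by blast
  then obtain k :: int where h: "h = x [^] k" using generate_pow[OF x(1)] by blast
  have "y = M #> x [^] k"
    using g mh h x coset_mult_assoc[OF N.subset N.mem_carrier[OF mh(1)], of h]
    by (simp add: coset_join2 N.subgroup_axioms)
  then show ?thesis using N.FactGroup_int_pow[OF x(1)] by metis
qed

lemma (in group) ex_nontrivial_endomorphism_killing_derived:
  assumes fin: "finite (carrier G)" and np: "derived G (carrier G) \<noteq> carrier G"
  obtains f x where "f \<in> hom G G" "x \<in> carrier G" "f x \<noteq> \<one>"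
    "\<And>d. d \<in> derived G (carrier G) \<Longrightarrow> f d = \<one>"
proof -
  obtain M where M: "subgroup M G" "derived G (carrier G) \<subseteq> M" "M \<noteq> carrier G"
    and max: "\<And>K. subgroup K G \<Longrightarrow> M \<subset> K \<Longrightarrow> K = carrier G"
    using ex_maximal_proper_subgroup[OF fin derived_is_subgroup[OF subset_refl] np] by metis
  have N: "M \<lhd> G" using M(1,2) by (rule subgroup_containing_derived_is_normal)
  interpret N: normal M G by fact
  interpret Q: group "G Mod M" by (rule N.factorgroup_is_group)
  have proj: "(\<lambda>g. M #> g) \<in> hom G (G Mod M)" by (rule N.r_coset_hom_Mod)
  obtain x where x: "x \<in> carrier G" "x \<notin> M" using M N.subset by blast
  let ?c = "M #> x"
  have c: "?c \<in> carrier (G Mod M)" using x by (auto simp: FactGroup_def RCOSETS_def)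
  have "?c \<noteq> \<one>\<^bsub>G Mod M\<^esub>" using rcos_self[OF x(1) N.subgroup_axioms] x(2)
    by (auto simp: FactGroup_def)
  then have n1: "Q.ord ?c \<noteq> 1" using Q.ord_eq_1[OF c] by simp
  have "?c [^]\<^bsub>G Mod M\<^esub> ord x = \<one>\<^bsub>G Mod M\<^esub>"
    using x N.FactGroup_pow[OF x(1)] by (simp add: FactGroup_def N.subset)
  then have n: "Q.ord ?c dvd ord x" using Q.pow_eq_id[OF c] by simp
  have o: "ord x \<noteq> 0" using ord_ge_1[OF fin x(1)] by simp
  define z where "z = x [^] (ord x div Q.ord ?c)"
  have z: "z \<in> carrier G" unfolding z_def using x by simp
  have oz: "ord z = Q.ord ?c"
  proof -
    obtain q where q: "ord x = Q.ord ?c * q" using n by (rule dvdE)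
    with o have "Q.ord ?c \<noteq> 0" "q \<noteq> 0" by auto
    then show ?thesis unfolding z_def using ord_pow[OF x(1), of q] q by simp
  qed
  obtain f where f: "f \<in> hom (G Mod M) G" "f ?c = z"
    using ex_hom_cyclic[OF Q.group_axioms group_axioms c quotient_by_maximal_cyclic[OF N max x] z]
      oz by auto
  show thesis
  proof (rule that[of "f \<circ> (\<lambda>g. M #> g)" x])
    show "f \<circ> (\<lambda>g. M #> g) \<in> hom G G" using proj f(1) by (rule Group.hom_compose)
    show "(f \<circ> (\<lambda>g. M #> g)) x \<noteq> \<one>" using f(2) oz n1 ord_eq_1[OF z] by simp
    fix d assume "d \<in> derived G (carrier G)"
    then have "M #> d = \<one>\<^bsub>G Mod M\<^esub>"
      using M(2) by (auto simp: FactGroup_def coset_join2 N.subgroup_axioms)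
    then show "(f \<circ> (\<lambda>g. M #> g)) d = \<one>"
      using hom_one[OF f(1) Q.group_axioms group_axioms] by simp
  qed (fact x(1))
qed

lemma hom_image_perfect_subset_derived:
  assumes "perfect_group H" "group G" "\<eta> \<in> hom H G"
  shows "\<eta> ` carrier H \<subseteq> derived G (carrier G)"
proof -
  interpret group_hom H G \<eta>
    using assms by (simp add: group_hom_def group_hom_axioms_def perfect_group_def)
  have "\<eta> ` carrier H = derived G (\<eta> ` carrier H)"
    using derived_img[of "carrier H"] assms(1) by (simp add: perfect_group_def)
  also have "\<dots> \<subseteq> derived G (carrier G)" by (intro H.mono_derived) auto
  finally show ?thesis .
qed

theorem theorem2p4:
  fixes H :: "('a, 'c) monoid_scheme" and G :: "('b, 'd) monoid_scheme" and \<eta> :: "'a \<Rightarrow> 'b"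
  assumes "perfect_group H"
    and "localization H G \<eta>"
    and "finite (carrier G)"
  shows "perfect_group G"
proof (rule ccontr)
  assume np: "\<not> perfect_group G"
  have G: "group G" and \<eta>: "\<eta> \<in> hom H G"
    and inj: "inj_on (\<lambda>\<psi>. compose (carrier H) \<psi> \<eta>) (ext_hom G G)"
    using assms(2) by (auto simp: localization_def bij_betw_def)
  interpret group G by (fact G)
  have D: "\<eta> h \<in> derived G (carrier G)" if "h \<in> carrier H" for h
    using hom_image_perfect_subset_derived[OF assms(1) G \<eta>] that by blast
  have "derived G (carrier G) \<noteq> carrier G" using np G by (simp add: perfect_group_def)
  from ex_nontrivial_endomorphism_killing_derived[OF assms(3) this]
  obtain f x where f: "f \<in> hom G G" and x: "x \<in> carrier G" "f x \<noteq> \<one>\<^bsub>G\<^esub>"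
    and fD: "\<And>d. d \<in> derived G (carrier G) \<Longrightarrow> f d = \<one>\<^bsub>G\<^esub>" by blast
  let ?f = "restrict f (carrier G)" and ?e = "\<lambda>g\<in>carrier G. \<one>\<^bsub>G\<^esub>"
  have "?f \<in> ext_hom G G" "?e \<in> ext_hom G G"
    using f by (auto simp: ext_hom_def hom_def)
  moreover have "compose (carrier H) ?f \<eta> = compose (carrier H) ?e \<eta>"
    using hom_in_carrier[OF \<eta>] D fD by (auto simp: compose_def fun_eq_iff)
  ultimately have "?f = ?e" using inj by (auto dest: inj_onD)
  then show False using x by (metis restrict_apply')
qed

end
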